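(* Let $K$ be a non-empty compact Hausdorff space, let $A$ be a unital uniform algebra on $C(K)$, and let $\partial A\subset K$ be its Choquet boundary. (a) $f,g\in A$ satisfy $f\perp_B g$ if and only if $$0\in\operatorname{conv}\{\theta g(s)\colon \theta\in\mathbb{T},\ s\in\partial A,\ f(s)=\overline{\theta}\|f\|\}.$$ (b) $f\in A$ is a smooth point of $A$ if and only if the set $$\{\theta g(s)\colon \theta\in\mathbb{T},\ s\in\partial A,\ f(s)=\overline{\theta}\|f\|\}$$ is a singleton for every $g\in A$.
   Context: $\mathbb{K}$ is $\mathbb{R}$ or $\mathbb{C}$, $\mathbb{T}$ is the set of modulus-one scalars of $\mathbb{K}$. $C(K)$ is the space of $\mathbb{K}$-valued continuous functions on $K$ with the supremum norm. A unital uniform algebra on $C(K)$ is a closed subalgebra $A$ of $C(K)$ which separates the points of $K$ and contains the constant functions. Its Choquet boundary is $\partial A:=\{s\in K\colon \delta_s|_A\in\operatorname{ext}(B_{A^*})\}$, where $\delta_s$ is evaluation at $s$, $B_{A^*}$ is the closed unit ball of $A^*$ and $\operatorname{ext}$ denotes the set of extreme points. $x\perp_B y$ (Birkhoff-James orthogonality) means $\|x+\lambda y\|\geq\|x\|$ for all $\lambda\in\mathbb{K}$. A point $z$ of a Banach space $Z$ is smooth if $\{\phi\in Z^*\colon\|\phi\|=1,\ \phi(z)=\|z\|\}$ is a singleton. $\operatorname{conv}$ is the convex hull. *)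

theory Defs
  imports "HOL-Analysis.Analysis" "HOL-Library.Function_Algebras"
begin

text \<open>
  The scalar field is a set \<open>\<KK>\<close> of complex numbers, which is either \<open>\<real>\<close> or \<open>UNIV\<close>. The compact
  Hausdorff space \<open>K\<close> is a whole type, and \<open>C(K)\<close> is the set of \<open>\<KK>\<close>-valued elements of the type
  of bounded continuous functions, whose norm is the supremum norm. Convexity and extreme points
  are taken over the reals.
\<close>

instantiation "fun" :: (type, real_vector) real_vector
begin

definition scaleR_fun :: "real \<Rightarrow> ('a \<Rightarrow> 'b) \<Rightarrow> 'a \<Rightarrow> 'b" where
  "scaleR_fun r f = (\<lambda>x. r *\<^sub>R f x)"

instance
  by intro_classes (auto simp: scaleR_fun_def plus_fun_def scaleR_add_right scaleR_add_left)

end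

definition continuous_functions :: "complex set \<Rightarrow> ('a::topological_space \<Rightarrow>\<^sub>C complex) set" where
  "continuous_functions \<KK> = {f. range (apply_bcontfun f) \<subseteq> \<KK>}"

definition cscale ::
  "complex \<Rightarrow> ('a::topological_space \<Rightarrow>\<^sub>C complex) \<Rightarrow> ('a \<Rightarrow>\<^sub>C complex)" where
  "cscale c f = Bcontfun (\<lambda>s. c * apply_bcontfun f s)"

definition cmult ::
  "('a::topological_space \<Rightarrow>\<^sub>C complex) \<Rightarrow> ('a \<Rightarrow>\<^sub>C complex) \<Rightarrow> ('a \<Rightarrow>\<^sub>C complex)" where
  "cmult f g = Bcontfun (\<lambda>s. apply_bcontfun f s * apply_bcontfun g s)"

lemma apply_cmult [simp]: "apply_bcontfun (cmult f g) s = apply_bcontfun f s * apply_bcontfun g s"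
proof -
  obtain a b where a: "\<And>s. norm (apply_bcontfun f s) \<le> a" and b: "\<And>s. norm (apply_bcontfun g s) \<le> b"
    using bounded_apply_bcontfun[of f] bounded_apply_bcontfun[of g] by (auto simp: bounded_iff)
  have "norm (apply_bcontfun f s * apply_bcontfun g s) \<le> a * b" for s
    using mult_mono'[OF a b] by (simp add: norm_mult)
  then have "(\<lambda>s. apply_bcontfun f s * apply_bcontfun g s) \<in> bcontfun"
    by (auto simp: bcontfun_def bounded_iff intro!: continuous_intros)
  then show ?thesis
    by (simp add: cmult_def Bcontfun_inverse)
qed

lemma apply_cscale [simp]: "apply_bcontfun (cscale c f) s = c * apply_bcontfun f s"
proof -
  have "cscale c f = cmult (const_bcontfun c) f"
    by (simp add: cscale_def cmult_def const_bcontfun.rep_eq)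
  then show ?thesis
    by (simp add: const_bcontfun.rep_eq)
qed

definition unital_uniform_algebra ::
  "complex set \<Rightarrow> ('a::topological_space \<Rightarrow>\<^sub>C complex) set \<Rightarrow> bool" where
  "unital_uniform_algebra \<KK> A \<longleftrightarrow>
     A \<subseteq> continuous_functions \<KK> \<and> closed A \<and>
     (\<forall>f\<in>A. \<forall>g\<in>A. f + g \<in> A) \<and>
     (\<forall>c\<in>\<KK>. \<forall>f\<in>A. cscale c f \<in> A) \<and>
     (\<forall>f\<in>A. \<forall>g\<in>A. cmult f g \<in> A) \<and>
     (\<forall>c\<in>\<KK>. const_bcontfun c \<in> A) \<and>
     (\<forall>s t. s \<noteq> t \<longrightarrow> (\<exists>f\<in>A. apply_bcontfun f s \<noteq> apply_bcontfun f t))"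

text \<open>
  Elements of \<open>A\<^sup>*\<close> are functions on \<open>A\<close> only. They are represented by their extensions by \<open>0\<close>
  outside \<open>A\<close>, so that equality of representatives is equality on \<open>A\<close> and the linear
  structure of \<open>A\<^sup>*\<close> is the pointwise one.
\<close>

definition dual_space ::
  "complex set \<Rightarrow> ('a::topological_space \<Rightarrow>\<^sub>C complex) set
    \<Rightarrow> (('a \<Rightarrow>\<^sub>C complex) \<Rightarrow> complex) set" where
  "dual_space \<KK> A = {\<phi>.
     (\<forall>f. f \<notin> A \<longrightarrow> \<phi> f = 0) \<and>
     (\<forall>f\<in>A. \<phi> f \<in> \<KK>) \<and>
     (\<forall>f\<in>A. \<forall>g\<in>A. \<phi> (f + g) = \<phi> f + \<phi> g) \<and>
     (\<forall>c\<in>\<KK>. \<forall>f\<in>A. \<phi> (cscale c f) = c * \<phi> f) \<and>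
     (\<exists>C. \<forall>f\<in>A. norm (\<phi> f) \<le> C * norm f)}"

definition dual_norm ::
  "('a::topological_space \<Rightarrow>\<^sub>C complex) set \<Rightarrow> (('a \<Rightarrow>\<^sub>C complex) \<Rightarrow> complex) \<Rightarrow> real" where
  "dual_norm A \<phi> = (SUP f\<in>{f \<in> A. norm f \<le> 1}. norm (\<phi> f))"

definition dual_ball ::
  "complex set \<Rightarrow> ('a::topological_space \<Rightarrow>\<^sub>C complex) set
    \<Rightarrow> (('a \<Rightarrow>\<^sub>C complex) \<Rightarrow> complex) set" where
  "dual_ball \<KK> A = {\<phi> \<in> dual_space \<KK> A. dual_norm A \<phi> \<le> 1}"

definition point_evaluation ::
  "('a::topological_space \<Rightarrow>\<^sub>C complex) set \<Rightarrow> 'a \<Rightarrow> ('a \<Rightarrow>\<^sub>C complex) \<Rightarrow> complex" where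
  "point_evaluation A s = (\<lambda>f. if f \<in> A then apply_bcontfun f s else 0)"

definition choquet_boundary ::
  "complex set \<Rightarrow> ('a::topological_space \<Rightarrow>\<^sub>C complex) set \<Rightarrow> 'a set" where
  "choquet_boundary \<KK> A = {s. point_evaluation A s extreme_point_of dual_ball \<KK> A}"

definition birkhoff_orthogonal ::
  "complex set \<Rightarrow> ('a::topological_space \<Rightarrow>\<^sub>C complex) \<Rightarrow> ('a \<Rightarrow>\<^sub>C complex) \<Rightarrow> bool" where
  "birkhoff_orthogonal \<KK> f g \<longleftrightarrow> (\<forall>c\<in>\<KK>. norm (f + cscale c g) \<ge> norm f)"

definition smooth_point ::
  "complex set \<Rightarrow> ('a::topological_space \<Rightarrow>\<^sub>C complex) set \<Rightarrow> ('a \<Rightarrow>\<^sub>C complex) \<Rightarrow> bool" where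
  "smooth_point \<KK> A f \<longleftrightarrow> f \<in> A \<and>
     is_singleton {\<phi> \<in> dual_space \<KK> A. dual_norm A \<phi> = 1 \<and> \<phi> f = of_real (norm f)}"

definition unimodular :: "complex set \<Rightarrow> complex set" where
  "unimodular \<KK> = {\<theta> \<in> \<KK>. norm \<theta> = 1}"

end

theory Submission
  imports Defs
begin

text \<open>
  Let \<open>X\<close> be the compact set of pairs \<open>(\<theta>, s)\<close>, acting on \<open>A\<close> by \<open>f \<mapsto> \<theta> f(s)\<close>. Call a non-empty
  closed \<open>Y \<subseteq> X\<close> facial if the functionals \<open>\<phi>\<close> in the dual ball with
  \<open>Re \<phi>(f) \<le> max\<^sub>Y Re (\<theta> f(s))\<close> for all \<open>f \<in> A\<close> form a face of the dual ball. The set \<open>X\<close> is facial,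
  intersections of chains of facial sets are facial, and the maximisers of \<open>Re (\<theta> f(s))\<close> on a facial
  set form a facial set: apply the domination to \<open>g + n f\<close> and let \<open>n \<longrightarrow> \<infinity>\<close>. A minimal facial set
  carries a single functional, which is therefore extreme, so every facial set contains a pair
  \<open>(\<theta>, s)\<close> with \<open>s \<in> \<partial>A\<close>. Neither the Hahn-Banach nor the Krein-Milman theorem is needed.

  If \<open>f \<bottom>\<^sub>B g\<close> but \<open>0\<close> lies outside the convex hull, separate it weakly by \<open>Re (l d) \<le> 0\<close>. The
  maximum of \<open>Re (l \<theta> g(s))\<close> over the pairs norming \<open>f\<close> is then \<open>0\<close>, and maximising
  \<open>\<plusminus>Im (l \<theta> g(s))\<close> over its maximisers gives two points of the set, on opposite sides of
  \<open>0\<close> on one line. For (b), each functional supporting \<open>f\<close> is dominated by the maximum over the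
  pairs norming \<open>f\<close>, and this maximum is attained over \<open>\<partial>A\<close>.
\<close>

section \<open>Chains of compact sets, and segments through 0 in the plane\<close>

text \<open>A finite non-empty subfamily of a chain has a least member, which is non-empty here, so
  the finite intersection property applies.\<close>

lemma compact_chain_Inter_nonempty:
  fixes \<F> :: "'b::t2_space set set"
  assumes "\<F> \<noteq> {}" and "\<And>S. S \<in> \<F> \<Longrightarrow> compact S" and "{} \<notin> \<F>"
    and chain: "\<And>S T. S \<in> \<F> \<Longrightarrow> T \<in> \<F> \<Longrightarrow> S \<subseteq> T \<or> T \<subseteq> S"
  shows "\<Inter> \<F> \<noteq> {}"
proof -
  obtain S where S: "S \<in> \<F>"
    using assms(1) by blast
  have "S \<inter> \<Inter> \<F> \<noteq> {}"
  proof (rule compact_imp_fip)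
    fix \<G> assume \<G>: "finite \<G>" "\<G> \<subseteq> \<F>"
    have "subset.chain UNIV (insert S \<G>)"
      using S \<G> chain by (auto simp: subset_chain_def)
    then have "\<Inter> (insert S \<G>) \<in> insert S \<G>"
      using \<G> by (intro Inter_in_chain[where \<A> = UNIV]) auto
    then show "S \<inter> \<Inter> \<G> \<noteq> {}"
      using S \<G> assms(3) by auto
  qed (use S assms(2) in \<open>auto intro: compact_imp_closed\<close>)
  then show ?thesis
    by blast
qed

text \<open>
  For compact \<open>Y\<close> and \<open>m = max\<^sub>Y u\<close>, the quantity \<open>max\<^sub>Y (v + n (u - m))\<close> decreases to the maximum of
  \<open>v\<close> over the maximisers of \<open>u\<close>.
\<close>

lemma compact_lexicographic_witness:
  fixes u v :: "'b::t2_space \<Rightarrow> real"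
  assumes Y: "compact Y" and u: "continuous_on Y u" and v: "continuous_on Y v"
    and le: "\<And>y. y \<in> Y \<Longrightarrow> u y \<le> m"
    and wit: "\<And>n::nat. \<exists>y\<in>Y. c \<le> v y + real n * (u y - m)"
  shows "\<exists>y\<in>Y. u y = m \<and> c \<le> v y"
proof -
  define F where "F n = {y \<in> Y. c \<le> v y + real n * (u y - m)}" for n
  have compactF: "compact (F n)" for n
  proof -
    have "closedin (top_of_set Y) (Y \<inter> (\<lambda>y. v y + real n * (u y - m)) -` {c..})"
      by (intro continuous_closedin_preimage continuous_intros u v closed_atLeast)
    moreover have "Y \<inter> (\<lambda>y. v y + real n * (u y - m)) -` {c..} = F n"
      by (auto simp: F_def)
    ultimately show ?thesis
      using Y closedin_compact by metis
  qed
  have mono: "F n \<subseteq> F k" if "k \<le> n" for k n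
  proof
    fix y assume y: "y \<in> F n"
    then have "real n * (u y - m) \<le> real k * (u y - m)"
      using le[of y] that by (intro mult_right_mono_neg) (auto simp: F_def)
    with y show "y \<in> F k"
      by (auto simp: F_def)
  qed
  have "\<Inter> (range F) \<noteq> {}"
  proof (rule compact_chain_Inter_nonempty)
    show "{} \<notin> range F"
      using wit by (force simp: F_def)
    show "S \<subseteq> T \<or> T \<subseteq> S" if "S \<in> range F" "T \<in> range F" for S T
      using that mono by (metis imageE le_cases)
  qed (use compactF in auto)
  then obtain y where y: "\<And>n. y \<in> F n"
    by auto
  have "y \<in> Y" and "c \<le> v y"
    using y[of 0] by (auto simp: F_def)
  moreover have "u y = m"
  proof (rule ccontr)
    assume "u y \<noteq> m"
    then have "m - u y > 0"
      using le \<open>y \<in> Y\<close> by force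
    then obtain n :: nat where "v y - c < real n * (m - u y)"
      using reals_Archimedean3 by blast
    with y[of n] show False
      by (simp add: F_def algebra_simps)
  qed
  ultimately show ?thesis
    by blast
qed

lemma Re_eq_imp_eq_of_real:
  assumes "Re z = r" and "norm z \<le> r"
  shows "z = of_real r"
proof -
  have "(Re z)\<^sup>2 + (Im z)\<^sup>2 \<le> r\<^sup>2"
    using assms power_mono[of "norm z" r 2] by (simp add: cmod_power2)
  with assms show ?thesis
    by (simp add: complex_eq_iff)
qed

text \<open>Multiplication by \<open>l\<close> moves both points to the imaginary axis, on opposite
  sides of 0 or at 0. The weights found there also serve \<open>a\<close> and \<open>b\<close>,
  because \<open>l\<close> is non-zero.\<close>

lemma zero_in_segment_if_Im_opposite:
  assumes "l \<noteq> 0" and "Re (l * a) = 0" and "Re (l * b) = 0"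
    and "Im (l * a) \<ge> 0" and "Im (l * b) \<le> 0"
  shows "(0::complex) \<in> closed_segment a b"
proof -
  have "0 \<in> closed_segment (l * a) (l * b)"
  proof (cases "Im (l * a) = Im (l * b)")
    case True
    with assms have "l * a = 0"
      by (simp add: complex_eq_iff del: mult_eq_0_iff)
    then show ?thesis
      by (simp only: ends_in_segment)
  next
    case False
    define p q where "p = Im (l * a)" and "q = Im (l * b)"
    have ab: "l * a = Complex 0 p" "l * b = Complex 0 q"
      using assms by (auto simp: p_def q_def complex_eq_iff)
    have "p - q > 0" "p \<ge> 0" "q \<le> 0"
      using assms False by (auto simp: p_def q_def)
    \<comment> \<open>The weight \<open>p / (p - q)\<close> solves
      \<open>(1 - u) * p + u * q = 0\<close>.\<close>
    then show ?thesis
      unfolding ab in_segment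
      by (intro exI[of _ "p / (p - q)"]) (auto simp: complex_eq_iff field_simps)
  qed
  then obtain u where u: "0 \<le> u" "u \<le> 1" "0 = (1 - u) *\<^sub>R (l * a) + u *\<^sub>R (l * b)"
    by (auto simp: in_segment)
  then have "l * ((1 - u) *\<^sub>R a + u *\<^sub>R b) = 0"
    by (simp add: algebra_simps)
  with assms(1) u show ?thesis
    unfolding in_segment by (metis mult_eq_0_iff)
qed

section \<open>Scalars, pairs acting on the algebra, and the dual ball\<close>

locale compact_uniform_algebra =
  fixes \<KK> :: "complex set"
    and A :: "('a::t2_space \<Rightarrow>\<^sub>C complex) set"
  assumes scalars: "\<KK> = \<real> \<or> \<KK> = UNIV"
    and compact_space: "compact (UNIV :: 'a set)"
    and algebra: "unital_uniform_algebra \<KK> A"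
begin

lemma add_closed: "f \<in> A \<Longrightarrow> g \<in> A \<Longrightarrow> f + g \<in> A"
  and scale_closed: "c \<in> \<KK> \<Longrightarrow> f \<in> A \<Longrightarrow> cscale c f \<in> A"
  and const_closed: "c \<in> \<KK> \<Longrightarrow> const_bcontfun c \<in> A"
  and values_in_scalars: "f \<in> A \<Longrightarrow> apply_bcontfun f s \<in> \<KK>"
  using algebra by (auto simp: unital_uniform_algebra_def continuous_functions_def)

lemma of_real_in_scalars [simp]: "complex_of_real r \<in> \<KK>"
  and one_in_scalars [simp]: "1 \<in> \<KK>"
  and minus_one_in_scalars [simp]: "-1 \<in> \<KK>"
  and scalars_mult: "a \<in> \<KK> \<Longrightarrow> b \<in> \<KK> \<Longrightarrow> a * b \<in> \<KK>"
  and scalars_add: "a \<in> \<KK> \<Longrightarrow> b \<in> \<KK> \<Longrightarrow> a + b \<in> \<KK>"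
  and scalars_cnj: "a \<in> \<KK> \<Longrightarrow> cnj a \<in> \<KK>"
  using scalars by (auto simp: Reals_cnj_iff)

definition phases :: "(complex \<times> 'a) set" where
  "phases = unimodular \<KK> \<times> UNIV"

text \<open>The value 0 outside \<open>A\<close> matches the representation of functionals in
  \<open>dual_space\<close>.\<close>

definition ev :: "complex \<times> 'a \<Rightarrow> ('a \<Rightarrow>\<^sub>C complex) \<Rightarrow> complex" where
  "ev x f = (if f \<in> A then fst x * apply_bcontfun f (snd x) else 0)"

text \<open>Using the real part makes this a set of maximisers of \<open>Re (ev x f)\<close> over
  \<open>phases\<close>. As \<open>norm (ev x f)\<close> is at most \<open>norm f\<close> there, the
  condition amounts to \<open>ev x f = norm f\<close>.\<close>

definition norming :: "('a \<Rightarrow>\<^sub>C complex) \<Rightarrow> (complex \<times> 'a) set" where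
  "norming f = {x \<in> phases. Re (ev x f) = norm f}"

lemma cscale_of_real: "cscale (of_real r) f = r *\<^sub>R f"
  by (rule bcontfun_eqI) (simp add: scaleR_conv_of_real)

lemma scaleR_closed: "f \<in> A \<Longrightarrow> r *\<^sub>R f \<in> A"
  using scale_closed[of "of_real r" f] by (simp add: cscale_of_real)

lemma ev_add: "f \<in> A \<Longrightarrow> g \<in> A \<Longrightarrow> ev x (f + g) = ev x f + ev x g"
  by (simp add: ev_def add_closed algebra_simps)

lemma ev_cscale: "c \<in> \<KK> \<Longrightarrow> f \<in> A \<Longrightarrow> ev x (cscale c f) = c * ev x f"
  by (simp add: ev_def scale_closed)

lemma ev_scaleR: "f \<in> A \<Longrightarrow> ev x (r *\<^sub>R f) = r *\<^sub>R ev x f"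
  using ev_cscale[of "of_real r" f x] by (simp add: cscale_of_real scaleR_conv_of_real)

lemma compact_phases: "compact phases"
proof -
  have "unimodular \<KK> = sphere 0 1 \<inter> \<KK>"
    by (auto simp: unimodular_def)
  moreover have "closed \<KK>"
    using scalars by (auto simp: closed_complex_Reals)
  ultimately have "compact (unimodular \<KK>)"
    by (simp add: compact_Int_closed)
  then show ?thesis
    unfolding phases_def by (intro compact_Times compact_space)
qed

lemma continuous_on_ev: "continuous_on Y (\<lambda>x. ev x f)"
proof (cases "f \<in> A")
  case True
  have "continuous_on Y (\<lambda>x. apply_bcontfun f (snd x))"
    by (rule continuous_on_compose2[OF continuous_on_apply_bcontfun[of UNIV]])
       (auto intro: continuous_intros)
  with True show ?thesis
    by (auto simp: ev_def intro!: continuous_intros)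
qed (simp add: ev_def)

lemma compact_subset_phases: "Y \<subseteq> phases \<Longrightarrow> closed Y \<Longrightarrow> compact Y"
  using compact_phases compact_Int_closed by (metis inf.absorb_iff2)

lemma norm_ev_le: "x \<in> phases \<Longrightarrow> norm (ev x f) \<le> norm f"
  using norm_bounded[of f "snd x"] by (auto simp: ev_def phases_def unimodular_def norm_mult)

lemma norm_attained:
  assumes "f \<in> A"
  obtains x where "x \<in> norming f"
proof -
  obtain s where s: "\<And>t. norm (apply_bcontfun f t) \<le> norm (apply_bcontfun f s)"
    using continuous_attains_sup[OF compact_space, of "\<lambda>t. norm (apply_bcontfun f t)"]
    by (auto intro: continuous_intros)
  then have eq: "norm (apply_bcontfun f s) = norm f"
    by (meson norm_bound norm_bounded order_antisym)
  \<comment> \<open>The conjugate phase of \<open>f\<close> at a point of maximal modulus, which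
    stays in the scalar field. If the value there is 0, then \<open>f = 0\<close> and 1 is as good
    as any phase.\<close>
  define \<theta> where
    "\<theta> = (if apply_bcontfun f s = 0 then 1
          else of_real (inverse (norm (apply_bcontfun f s))) * cnj (apply_bcontfun f s))"
  have "\<theta> \<in> \<KK>"
    using values_in_scalars[OF assms, of s] unfolding \<theta>_def
    by (auto intro!: scalars_mult scalars_cnj simp del: of_real_inverse)
  then have "\<theta> \<in> unimodular \<KK>"
    by (auto simp: unimodular_def \<theta>_def norm_mult norm_inverse)
  moreover have "\<theta> * apply_bcontfun f s = of_real (norm f)"
  proof (cases "apply_bcontfun f s = 0")
    case False
    have "\<theta> * apply_bcontfun f s = of_real (inverse (norm (apply_bcontfun f s))) *
        (apply_bcontfun f s * cnj (apply_bcontfun f s))"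
      using False by (simp only: \<theta>_def if_False mult.assoc mult.commute[of "cnj _"])
    also have "\<dots> =
        of_real (inverse (norm (apply_bcontfun f s)) * (norm (apply_bcontfun f s))\<^sup>2)"
      by (simp only: complex_norm_square[symmetric] of_real_mult of_real_power)
    also have "inverse (norm (apply_bcontfun f s)) * (norm (apply_bcontfun f s))\<^sup>2 = norm f"
      using False unfolding eq[symmetric] by (simp add: power2_eq_square)
    finally show ?thesis .
  qed (use eq in simp)
  ultimately have "(\<theta>, s) \<in> norming f"
    using assms by (simp add: norming_def phases_def ev_def del: times_complex.sel)
  then show ?thesis ..
qed

lemma ev_norming: "x \<in> norming f \<Longrightarrow> ev x f = of_real (norm f)"
  by (auto simp: norming_def intro: Re_eq_imp_eq_of_real norm_ev_le)

lemma ev_in_dual_space: "x \<in> phases \<Longrightarrow> ev x \<in> dual_space \<KK> A"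
  unfolding dual_space_def
  by (auto simp: ev_add ev_cscale intro!: exI[of _ 1] norm_ev_le)
     (auto simp: ev_def phases_def unimodular_def intro!: scalars_mult values_in_scalars)

lemma dual_space_scaleR:
  assumes "\<phi> \<in> dual_space \<KK> A" and "f \<in> A"
  shows "\<phi> (r *\<^sub>R f) = r *\<^sub>R \<phi> f"
proof -
  have "\<phi> (cscale (of_real r) f) = of_real r * \<phi> f"
    using assms by (simp add: dual_space_def)
  then show ?thesis
    by (simp add: cscale_of_real scaleR_conv_of_real)
qed

lemma dual_norm_le_iff:
  assumes "\<phi> \<in> dual_space \<KK> A"
  shows "dual_norm A \<phi> \<le> 1 \<longleftrightarrow> (\<forall>f\<in>A. norm (\<phi> f) \<le> norm f)"
proof
  have zero: "0 \<in> A"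
    using const_closed[of 0] of_real_in_scalars[of 0] by simp
  {
    assume "\<forall>f\<in>A. norm (\<phi> f) \<le> norm f"
    then show "dual_norm A \<phi> \<le> 1"
      unfolding dual_norm_def using zero by (intro cSUP_least) force+
  }
  assume le: "dual_norm A \<phi> \<le> 1"
  obtain C where C: "\<And>f. f \<in> A \<Longrightarrow> norm (\<phi> f) \<le> C * norm f"
    using assms unfolding dual_space_def by blast
  \<comment> \<open>A real \<open>SUP\<close> is an upper bound only for a set that is bounded
    above; the constant \<open>C\<close> of the functional supplies this.\<close>
  have bdd: "bdd_above ((\<lambda>f. norm (\<phi> f)) ` {f \<in> A. norm f \<le> 1})"
  proof (rule bdd_aboveI2)
    fix f assume f: "f \<in> {f \<in> A. norm f \<le> 1}"
    then have "norm (\<phi> f) \<le> \<bar>C\<bar> * norm f"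
      using C[of f] mult_right_mono[OF abs_ge_self, of "norm f" C] by simp
    also have "\<dots> \<le> \<bar>C\<bar>"
      using f by (simp add: mult_left_le)
    finally show "norm (\<phi> f) \<le> \<bar>C\<bar>" .
  qed
  show "\<forall>f\<in>A. norm (\<phi> f) \<le> norm f"
  proof
    fix f assume f: "f \<in> A"
    show "norm (\<phi> f) \<le> norm f"
    proof (cases "f = 0")
      case True
      with C[OF f] show ?thesis by simp
    next
      case False
      have "norm (\<phi> (inverse (norm f) *\<^sub>R f)) \<le> dual_norm A \<phi>"
        unfolding dual_norm_def using f False by (intro cSUP_upper bdd) (auto intro: scaleR_closed)
      then have "inverse (norm f) * norm (\<phi> f) \<le> 1"
        using le by (simp add: dual_space_scaleR[OF assms f])
      with False show ?thesis
        by (simp add: field_simps)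
    qed
  qed
qed

lemma dual_ball_iff:
  "\<phi> \<in> dual_ball \<KK> A \<longleftrightarrow> \<phi> \<in> dual_space \<KK> A \<and> (\<forall>f\<in>A. norm (\<phi> f) \<le> norm f)"
  by (auto simp: dual_ball_def dual_norm_le_iff)

lemma dual_norm_eq_1I:
  assumes "\<phi> \<in> dual_ball \<KK> A" and "f \<in> A" and "norm f = 1" and "norm (\<phi> f) = 1"
  shows "dual_norm A \<phi> = 1"
proof (rule antisym)
  show "dual_norm A \<phi> \<le> 1"
    using assms by (simp add: dual_ball_def)
  have "bdd_above ((\<lambda>f. norm (\<phi> f)) ` {f \<in> A. norm f \<le> 1})"
    using assms by (intro bdd_aboveI2[of _ _ 1]) (force simp: dual_ball_iff)
  then have "norm (\<phi> f) \<le> dual_norm A \<phi>"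
    unfolding dual_norm_def using assms by (intro cSUP_upper) auto
  with assms show "1 \<le> dual_norm A \<phi>"
    by simp
qed

lemma ev_in_dual_ball: "x \<in> phases \<Longrightarrow> ev x \<in> dual_ball \<KK> A"
  by (simp add: dual_ball_iff ev_in_dual_space norm_ev_le)

text \<open>The norm is attained at the constant function 1, where \<open>ev x\<close> has modulus
  1.\<close>

lemma dual_norm_ev: "x \<in> phases \<Longrightarrow> dual_norm A (ev x) = 1"
proof (rule dual_norm_eq_1I[where f = "const_bcontfun 1"])
  have "norm (const_bcontfun 1 :: 'a \<Rightarrow>\<^sub>C complex) \<le> 1"
    by (rule norm_bound) (simp add: const_bcontfun.rep_eq)
  moreover have "norm (apply_bcontfun (const_bcontfun 1 :: 'a \<Rightarrow>\<^sub>C complex) undefined) \<le> norm (const_bcontfun 1 :: 'a \<Rightarrow>\<^sub>C complex)"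
    by (rule norm_bounded)
  ultimately show "norm (const_bcontfun 1 :: 'a \<Rightarrow>\<^sub>C complex) = 1"
    by (simp add: const_bcontfun.rep_eq)
qed (auto simp: ev_in_dual_ball const_closed ev_def phases_def unimodular_def const_bcontfun.rep_eq)

lemma convex_dual_ball: "convex (dual_ball \<KK> A)"
proof (rule convexI)
  fix \<phi> \<psi> :: "('a \<Rightarrow>\<^sub>C complex) \<Rightarrow> complex" and u v :: real
  assume \<phi>: "\<phi> \<in> dual_ball \<KK> A" and \<psi>: "\<psi> \<in> dual_ball \<KK> A" and uv: "0 \<le> u" "0 \<le> v" "u + v = 1"
  define \<omega> where "\<omega> = u *\<^sub>R \<phi> + v *\<^sub>R \<psi>"
  have eq: "\<omega> f = of_real u * \<phi> f + of_real v * \<psi> f" for f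
    by (simp add: \<omega>_def plus_fun_def scaleR_fun_def scaleR_conv_of_real)
  have le: "norm (\<omega> f) \<le> norm f" if f: "f \<in> A" for f
  proof -
    have "norm (\<omega> f) \<le> u * norm (\<phi> f) + v * norm (\<psi> f)"
      unfolding eq using uv by (intro norm_triangle_le) (simp add: norm_mult)
    also have "\<dots> \<le> norm f"
      using \<phi> \<psi> f uv by (intro convex_bound_le) (auto simp: dual_ball_iff)
    finally show ?thesis .
  qed
  have "\<exists>C. \<forall>f\<in>A. norm (\<omega> f) \<le> C * norm f"
    using le by (intro exI[of _ 1]) simp
  then have "\<omega> \<in> dual_space \<KK> A"
    using \<phi> \<psi> unfolding dual_space_def dual_ball_iff
    by (auto simp: eq algebra_simps intro!: scalars_add scalars_mult)
  with le show "u *\<^sub>R \<phi> + v *\<^sub>R \<psi> \<in> dual_ball \<KK> A"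
    by (simp add: dual_ball_iff flip: \<omega>_def)
qed

text \<open>Applying the inequality to \<open>-f\<close> as well gives equal real parts. Over the
  complex scalars, \<open>\<i> f\<close> then gives the imaginary parts; over the reals these
  vanish.\<close>

lemma Re_le_imp_eq:
  assumes \<phi>: "\<phi> \<in> dual_space \<KK> A" and \<psi>: "\<psi> \<in> dual_space \<KK> A"
    and le: "\<And>f. f \<in> A \<Longrightarrow> Re (\<phi> f) \<le> Re (\<psi> f)"
  shows "\<phi> = \<psi>"
proof
  fix f
  show "\<phi> f = \<psi> f"
  proof (cases "f \<in> A")
    case f: True
    have Re: "Re (\<phi> g) = Re (\<psi> g)" if "g \<in> A" for g
      using le[OF that] le[OF scaleR_closed[OF that, of "-1"]]
      by (simp only: dual_space_scaleR[OF \<phi> that] dual_space_scaleR[OF \<psi> that]) simp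
    show ?thesis
    proof (cases "\<KK> = UNIV")
      case True
      then have "Re (\<i> * \<phi> f) = Re (\<i> * \<psi> f)"
        using Re[OF scale_closed[of \<i> f]] \<phi> \<psi> f by (simp add: dual_space_def)
      with Re[OF f] show ?thesis
        by (simp add: complex_eq_iff)
    next
      case False
      then have "\<phi> f \<in> \<real>" "\<psi> f \<in> \<real>"
        using scalars \<phi> \<psi> f by (auto simp: dual_space_def)
      with Re[OF f] show ?thesis
        by (simp add: complex_eq_iff complex_is_Real_iff)
    qed
  qed (use \<phi> \<psi> in \<open>simp add: dual_space_def\<close>)
qed

section \<open>Faces of the dual ball given by sets of pairs\<close>

text \<open>For compact \<open>Y\<close> inside \<open>phases\<close> this is the weak-star closed
  convex hull of the functionals \<open>ev y\<close>, described by its support function. Asking for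
  a witness \<open>y\<close> keeps suprema out of the definition.\<close>

definition dominated :: "(complex \<times> 'a) set \<Rightarrow> (('a \<Rightarrow>\<^sub>C complex) \<Rightarrow> complex) set" where
  "dominated Y = {\<phi> \<in> dual_ball \<KK> A. \<forall>f\<in>A. \<exists>y\<in>Y. Re (\<phi> f) \<le> Re (ev y f)}"

definition facial :: "(complex \<times> 'a) set \<Rightarrow> bool" where
  "facial Y \<longleftrightarrow> Y \<subseteq> phases \<and> closed Y \<and> Y \<noteq> {} \<and> dominated Y face_of dual_ball \<KK> A"

lemma facial_attains_max:
  assumes "facial Y"
  obtains z where "z \<in> Y" "\<And>w. w \<in> Y \<Longrightarrow> Re (ev w f) \<le> Re (ev z f)"
proof -
  have "compact Y" "Y \<noteq> {}"
    using assms by (auto simp: facial_def intro: compact_subset_phases)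
  moreover have "continuous_on Y (\<lambda>w. Re (ev w f))"
    by (intro continuous_intros continuous_on_ev)
  ultimately have "\<exists>z\<in>Y. \<forall>w\<in>Y. Re (ev w f) \<le> Re (ev z f)"
    by (intro continuous_attains_sup)
  with that show thesis
    by blast
qed

lemma dominated_mono: "Y \<subseteq> Z \<Longrightarrow> dominated Y \<subseteq> dominated Z"
  unfolding dominated_def by blast

text \<open>Of the two witnesses, the one with the larger value dominates the convex
  combination.\<close>

lemma convex_dominated: "convex (dominated Y)"
proof (rule convexI)
  fix \<phi> \<psi> :: "('a \<Rightarrow>\<^sub>C complex) \<Rightarrow> complex" and u v :: real
  assume \<phi>: "\<phi> \<in> dominated Y" and \<psi>: "\<psi> \<in> dominated Y" and uv: "0 \<le> u" "0 \<le> v" "u + v = 1"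
  have "u *\<^sub>R \<phi> + v *\<^sub>R \<psi> \<in> dual_ball \<KK> A"
    using \<phi> \<psi> uv by (intro convexD[OF convex_dual_ball]) (auto simp: dominated_def)
  moreover have "\<exists>y\<in>Y. Re ((u *\<^sub>R \<phi> + v *\<^sub>R \<psi>) f) \<le> Re (ev y f)" if "f \<in> A" for f
  proof -
    obtain y z where yz: "y \<in> Y" "Re (\<phi> f) \<le> Re (ev y f)" "z \<in> Y" "Re (\<psi> f) \<le> Re (ev z f)"
      using \<phi> \<psi> \<open>f \<in> A\<close> unfolding dominated_def by blast
    have "Re ((u *\<^sub>R \<phi> + v *\<^sub>R \<psi>) f) = u * Re (\<phi> f) + v * Re (\<psi> f)"
      by (simp add: plus_fun_def scaleR_fun_def)
    also have "\<dots> \<le> max (Re (ev y f)) (Re (ev z f))"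
      using yz uv by (intro convex_bound_le) auto
    finally show ?thesis
      using yz by (auto simp: max_def split: if_splits)
  qed
  ultimately show "u *\<^sub>R \<phi> + v *\<^sub>R \<psi> \<in> dominated Y"
    by (simp add: dominated_def)
qed

text \<open>A pair norming \<open>f\<close> is a witness, because \<open>Re (\<phi> f)\<close> is at
  most \<open>norm f\<close>.\<close>

lemma dominated_phases: "dominated phases = dual_ball \<KK> A"
proof -
  have "\<exists>y\<in>phases. Re (\<phi> f) \<le> Re (ev y f)" if \<phi>: "\<phi> \<in> dual_ball \<KK> A" and f: "f \<in> A" for \<phi> f
  proof -
    obtain y where "y \<in> norming f"
      using norm_attained[OF f] .
    moreover have "Re (\<phi> f) \<le> norm f"
      using \<phi> f complex_Re_le_cmod[of "\<phi> f"] by (fastforce simp: dual_ball_iff)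
    ultimately show ?thesis
      by (intro bexI[of _ y]) (auto simp: norming_def)
  qed
  then show ?thesis
    by (auto simp: dominated_def)
qed

lemma facial_phases: "facial phases"
proof -
  have "(1, undefined) \<in> phases"
    by (simp add: phases_def unimodular_def)
  then have "phases \<noteq> {}"
    by blast
  then show ?thesis
    by (simp add: facial_def dominated_phases compact_imp_closed[OF compact_phases]
        face_of_refl[OF convex_dual_ball])
qed

text \<open>From left to right, domination at \<open>f\<close> and at \<open>-f\<close> pins
  \<open>Re (\<phi> f)\<close> to \<open>m\<close>. From right to left, adding large multiples of
  \<open>f\<close> to \<open>g\<close> forces the witnesses for \<open>g\<close> to maximise
  \<open>f\<close> in the limit.\<close>

lemma dominated_maximisers:
  assumes Y: "Y \<subseteq> phases" "closed Y" and f: "f \<in> A"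
    and le: "\<And>y. y \<in> Y \<Longrightarrow> Re (ev y f) \<le> m"
  shows "dominated {y \<in> Y. Re (ev y f) = m} = {\<phi> \<in> dominated Y. Re (\<phi> f) = m}" (is "?L = ?R")
proof
  show "?L \<subseteq> ?R"
  proof
    fix \<phi> assume \<phi>: "\<phi> \<in> ?L"
    then have \<phi>_dual: "\<phi> \<in> dual_space \<KK> A"
      by (simp add: dominated_def dual_ball_iff)
    obtain y where y: "Re (ev y f) = m" "Re (\<phi> f) \<le> Re (ev y f)"
      using \<phi> f unfolding dominated_def by blast
    obtain z where z: "Re (ev z f) = m" "Re (\<phi> ((-1) *\<^sub>R f)) \<le> Re (ev z ((-1) *\<^sub>R f))"
      using \<phi> scaleR_closed[OF f, of "-1"] unfolding dominated_def by blast
    have "m \<le> Re (\<phi> f)"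
      using z(2) unfolding dual_space_scaleR[OF \<phi>_dual f] ev_scaleR[OF f] by (simp add: z(1))
    with y have "Re (\<phi> f) = m"
      by simp
    moreover have "\<phi> \<in> dominated Y"
      using \<phi> dominated_mono[of "{y \<in> Y. Re (ev y f) = m}" Y] by blast
    ultimately show "\<phi> \<in> ?R"
      by simp
  qed
  show "?R \<subseteq> ?L"
  proof
    fix \<phi> assume "\<phi> \<in> ?R"
    then have \<phi>: "\<phi> \<in> dominated Y" and m: "Re (\<phi> f) = m" and ball: "\<phi> \<in> dual_ball \<KK> A"
      and dual: "\<phi> \<in> dual_space \<KK> A"
      by (auto simp: dominated_def dual_ball_iff)
    have "\<exists>y\<in>{y \<in> Y. Re (ev y f) = m}. Re (\<phi> g) \<le> Re (ev y g)" if g: "g \<in> A" for g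
    proof -
      have "\<exists>y\<in>Y. Re (ev y f) = m \<and> Re (\<phi> g) \<le> Re (ev y g)"
      proof (rule compact_lexicographic_witness[OF compact_subset_phases[OF Y]])
        fix n :: nat
        have nf: "real n *\<^sub>R f \<in> A"
          using f by (rule scaleR_closed)
        \<comment> \<open>Subtracting \<open>n * m\<close>, the value of \<open>Re \<phi>\<close> at
          \<open>n f\<close>, from both sides leaves the inequality required for the limit.\<close>
        obtain y where "y \<in> Y" "Re (\<phi> (g + real n *\<^sub>R f)) \<le> Re (ev y (g + real n *\<^sub>R f))"
          using \<phi> add_closed[OF g nf] unfolding dominated_def by blast
        moreover have "\<phi> (g + real n *\<^sub>R f) = \<phi> g + \<phi> (real n *\<^sub>R f)"
          using dual g nf unfolding dual_space_def by blast
        ultimately show "\<exists>y\<in>Y. Re (\<phi> g) \<le> Re (ev y g) + real n * (Re (ev y f) - m)"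
          by (intro bexI[of _ y])
             (auto simp: ev_add g nf ev_scaleR f dual_space_scaleR[OF dual f] m algebra_simps)
      qed (auto intro!: continuous_intros continuous_on_ev le)
      then show ?thesis
        by blast
    qed
    with ball show "\<phi> \<in> ?L"
      by (simp add: dominated_def)
  qed
qed

text \<open>On \<open>dominated Y\<close> the number \<open>m\<close> bounds
  \<open>Re (\<phi> f)\<close>, so the level set at \<open>m\<close> is a face of
  \<open>dominated Y\<close>, and a face of a face is a face.\<close>

lemma facial_maximisers:
  assumes Y: "facial Y" and f: "f \<in> A" and y0: "y0 \<in> Y" "Re (ev y0 f) = m"
    and le: "\<And>y. y \<in> Y \<Longrightarrow> Re (ev y f) \<le> m"
  shows "facial {y \<in> Y. Re (ev y f) = m}"
proof -
  have Y': "Y \<subseteq> phases" "closed Y" and face: "dominated Y face_of dual_ball \<KK> A"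
    using Y by (auto simp: facial_def)
  have "{\<phi> \<in> dominated Y. Re (\<phi> f) = m} face_of dominated Y"
    unfolding face_of_def
  proof (intro conjI ballI impI)
    show "convex {\<phi> \<in> dominated Y. Re (\<phi> f) = m}"
      using convex_dominated[of "{y \<in> Y. Re (ev y f) = m}"] dominated_maximisers[OF Y' f le] by simp
    fix \<phi> \<psi> \<xi>
    assume \<phi>: "\<phi> \<in> dominated Y" and \<psi>: "\<psi> \<in> dominated Y"
      and \<xi>: "\<xi> \<in> {\<phi> \<in> dominated Y. Re (\<phi> f) = m}" "\<xi> \<in> open_segment \<phi> \<psi>"
    obtain u where u: "0 < u" "u < 1" "\<xi> = (1 - u) *\<^sub>R \<phi> + u *\<^sub>R \<psi>"
      using \<xi>(2) by (auto simp: in_segment)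
    then have avg: "(1 - u) * Re (\<phi> f) + u * Re (\<psi> f) = m"
      using \<xi>(1) by (simp add: plus_fun_def scaleR_fun_def)
    have "Re (\<rho> f) \<le> m" if \<rho>: "\<rho> \<in> dominated Y" for \<rho>
    proof -
      obtain y where "y \<in> Y" "Re (\<rho> f) \<le> Re (ev y f)"
        using \<rho> f unfolding dominated_def by blast
      with le show ?thesis
        by (meson order_trans)
    qed
    \<comment> \<open>Both endpoints have a non-negative defect from \<open>m\<close>; the weighted
      defects add up to 0, so each vanishes.\<close>
    then have "(1 - u) * (m - Re (\<phi> f)) \<ge> 0" "u * (m - Re (\<psi> f)) \<ge> 0"
      using \<phi> \<psi> u by simp_all
    moreover have "(1 - u) * (m - Re (\<phi> f)) + u * (m - Re (\<psi> f)) = 0"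
      using avg by (simp add: algebra_simps)
    ultimately have "Re (\<phi> f) = m" "Re (\<psi> f) = m"
      using u by (simp_all add: add_nonneg_eq_0_iff)
    with \<phi> \<psi> show "\<phi> \<in> {\<phi> \<in> dominated Y. Re (\<phi> f) = m}" "\<psi> \<in> {\<phi> \<in> dominated Y. Re (\<phi> f) = m}"
      by auto
  qed auto
  then have "dominated {y \<in> Y. Re (ev y f) = m} face_of dual_ball \<KK> A"
    using face_of_trans face by (simp only: dominated_maximisers[OF Y' f le])
  moreover have "closed {y \<in> Y. Re (ev y f) = m}"
  proof -
    have "closed (Y \<inter> (\<lambda>y. Re (ev y f)) -` {m})"
      by (intro continuous_closed_preimage continuous_intros continuous_on_ev Y' closed_singleton)
    moreover have "Y \<inter> (\<lambda>y. Re (ev y f)) -` {m} = {y \<in> Y. Re (ev y f) = m}"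
      by auto
    ultimately show ?thesis
      by simp
  qed
  moreover have "y0 \<in> {y \<in> Y. Re (ev y f) = m}"
    using y0 by simp
  ultimately show ?thesis
    using Y'(1) unfolding facial_def by blast
qed

text \<open>Faces are stable under intersection, so the point is that \<open>dominated\<close>
  commutes with the intersection of the chain. For fixed \<open>f\<close> the witnesses in the
  members form a chain of non-empty compact sets, hence share a point.\<close>

lemma facial_chain_Inter:
  assumes ne: "\<C> \<noteq> {}" and facial: "\<And>Y. Y \<in> \<C> \<Longrightarrow> facial Y"
    and chain: "\<And>Y Z. Y \<in> \<C> \<Longrightarrow> Z \<in> \<C> \<Longrightarrow> Y \<subseteq> Z \<or> Z \<subseteq> Y"
  shows "facial (\<Inter> \<C>)"
proof -
  have compact: "compact Y" if "Y \<in> \<C>" for Y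
    using facial[OF that] by (auto simp: facial_def intro: compact_subset_phases)
  have "\<Inter> \<C> \<noteq> {}"
    using ne compact facial chain by (intro compact_chain_Inter_nonempty) (auto simp: facial_def)
  moreover have "dominated (\<Inter> \<C>) = \<Inter> (dominated ` \<C>)"
  proof
    show "dominated (\<Inter> \<C>) \<subseteq> \<Inter> (dominated ` \<C>)"
      by (intro INT_greatest dominated_mono Inter_lower)
    show "\<Inter> (dominated ` \<C>) \<subseteq> dominated (\<Inter> \<C>)"
    proof
      fix \<phi> assume \<phi>: "\<phi> \<in> \<Inter> (dominated ` \<C>)"
      have "\<exists>y\<in>\<Inter> \<C>. Re (\<phi> f) \<le> Re (ev y f)" if f: "f \<in> A" for f
      proof -
        define above where "above Y = Y \<inter> (\<lambda>y. Re (ev y f)) -` {Re (\<phi> f)..}" for Y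
        have "\<Inter> (above ` \<C>) \<noteq> {}"
        proof (rule compact_chain_Inter_nonempty)
          show "compact S" if "S \<in> above ` \<C>" for S
          proof -
            obtain Y where Y: "Y \<in> \<C>" "S = above Y"
              using \<open>S \<in> above ` \<C>\<close> by blast
            have "closedin (top_of_set Y) (above Y)"
              unfolding above_def
              by (intro continuous_closedin_preimage continuous_intros continuous_on_ev closed_atLeast)
            then show ?thesis
              using Y compact closedin_compact by blast
          qed
          have "above Y \<noteq> {}" if Y: "Y \<in> \<C>" for Y
          proof -
            have "\<phi> \<in> dominated Y"
              using \<phi> Y by blast
            then obtain y where "y \<in> Y" "Re (\<phi> f) \<le> Re (ev y f)"
              using f unfolding dominated_def by blast
            then show ?thesis
              by (auto simp: above_def)
          qed
          then show "{} \<notin> above ` \<C>"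
            by blast
          show "S \<subseteq> T \<or> T \<subseteq> S" if "S \<in> above ` \<C>" "T \<in> above ` \<C>" for S T
            using that chain unfolding above_def by blast
        qed (use ne in auto)
        with ne show ?thesis
          by (auto simp: above_def)
      qed
      moreover have "\<phi> \<in> dual_ball \<KK> A"
        using \<phi> ne by (auto simp: dominated_def)
      ultimately show "\<phi> \<in> dominated (\<Inter> \<C>)"
        by (simp add: dominated_def)
    qed
  qed
  moreover have "\<Inter> \<C> \<subseteq> phases" "closed (\<Inter> \<C>)"
    using ne facial by (auto simp: facial_def)
  moreover have "\<Inter> (dominated ` \<C>) face_of dual_ball \<KK> A"
    using ne facial by (intro face_of_Inter) (auto simp: facial_def)
  ultimately show ?thesis
    by (simp add: facial_def)
qed

section \<open>Minimal facial sets and the Choquet boundary\<close>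

text \<open>Zorn's lemma for reverse inclusion, with intersections as bounds; the empty chain is
  bounded by \<open>Y\<close> itself.\<close>

lemma facial_has_minimal:
  assumes "facial Y"
  obtains Z where "facial Z" "Z \<subseteq> Y" "\<And>W. facial W \<Longrightarrow> W \<subseteq> Z \<Longrightarrow> W = Z"
proof -
  define P where "P = {Z. facial Z \<and> Z \<subseteq> Y}"
  have "\<exists>Z\<in>P. \<forall>W\<in>P. Z \<supseteq> W \<longrightarrow> W = Z"
  proof (rule predicate_Zorn)
    show "partial_order_on P (relation_of (\<supseteq>) P)"
      by (rule partial_order_on_relation_ofI) auto
    fix \<C> assume "\<C> \<in> Chains (relation_of (\<supseteq>) P)"
    then have \<C>: "\<C> \<subseteq> P" "\<And>S T. S \<in> \<C> \<Longrightarrow> T \<in> \<C> \<Longrightarrow> S \<subseteq> T \<or> T \<subseteq> S"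
      by (auto simp: Chains_def relation_of_def)
    show "\<exists>u\<in>P. \<forall>a\<in>\<C>. u \<subseteq> a"
    proof (cases "\<C> = {}")
      case True
      with assms show ?thesis
        by (auto simp: P_def)
    next
      case False
      then have "facial (\<Inter> \<C>)"
        using \<C> by (intro facial_chain_Inter) (auto simp: P_def)
      moreover have "\<Inter> \<C> \<subseteq> Y"
        using \<C>(1) False by (force simp: P_def)
      ultimately show ?thesis
        by (intro bexI[of _ "\<Inter> \<C>"]) (auto simp: P_def)
    qed
  qed
  then obtain Z where "facial Z" "Z \<subseteq> Y" "\<And>W. facial W \<Longrightarrow> W \<subseteq> Y \<Longrightarrow> W \<subseteq> Z \<Longrightarrow> W = Z"
    unfolding P_def by blast
  then show thesis
    by (meson that order_trans)
qed

text \<open>Multiplication by the unimodular \<open>\<theta>\<close> is injective, maps the dual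
  ball into itself and sends evaluation at \<open>s\<close> to \<open>ev x\<close>. A segment
  through the evaluation would rotate to a segment through \<open>ev x\<close>.\<close>

lemma extreme_ev_imp_choquet:
  assumes x: "x \<in> phases" and ext: "ev x extreme_point_of dual_ball \<KK> A"
  shows "snd x \<in> choquet_boundary \<KK> A"
proof -
  obtain \<theta> s where xs: "x = (\<theta>, s)" and \<theta>: "\<theta> \<in> unimodular \<KK>"
    using x by (auto simp: phases_def)
  have unit: "norm \<theta> = 1" and \<theta>_scalar: "\<theta> \<in> \<KK>"
    using \<theta> by (auto simp: unimodular_def)
  have "(1, s) \<in> phases"
    by (simp add: phases_def unimodular_def)
  moreover have eval: "point_evaluation A s = ev (1, s)"
    by (auto simp: point_evaluation_def ev_def)
  moreover have "ev (1, s) \<notin> open_segment a b" if a: "a \<in> dual_ball \<KK> A" and b: "b \<in> dual_ball \<KK> A" for a b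
  proof
    define rot where "rot \<phi> = (\<lambda>f. \<theta> * \<phi> f)" for \<phi> :: "('a \<Rightarrow>\<^sub>C complex) \<Rightarrow> complex"
    have ball: "rot \<phi> \<in> dual_ball \<KK> A" if "\<phi> \<in> dual_ball \<KK> A" for \<phi>
      using that unit \<theta>_scalar unfolding dual_ball_iff dual_space_def rot_def
      by (auto simp: norm_mult algebra_simps intro: scalars_mult)
    assume "ev (1, s) \<in> open_segment a b"
    then obtain u where u: "a \<noteq> b" "0 < u" "u < 1" "ev (1, s) = (1 - u) *\<^sub>R a + u *\<^sub>R b"
      by (auto simp: in_segment)
    have "rot a \<noteq> rot b"
      using u(1) unit by (auto simp: rot_def fun_eq_iff)
    moreover have "ev x = (1 - u) *\<^sub>R rot a + u *\<^sub>R rot b"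
    proof
      fix f
      have "ev x f = \<theta> * ev (1, s) f"
        by (simp add: xs ev_def)
      then show "ev x f = ((1 - u) *\<^sub>R rot a + u *\<^sub>R rot b) f"
        unfolding u(4) by (simp add: rot_def plus_fun_def scaleR_fun_def algebra_simps)
    qed
    ultimately have "ev x \<in> open_segment (rot a) (rot b)"
      using u by (auto simp: in_segment)
    with ext ball a b show False
      by (auto simp: extreme_point_of_def)
  qed
  ultimately show ?thesis
    by (simp add: choquet_boundary_def extreme_point_of_def ev_in_dual_ball xs)
qed

lemma facial_meets_choquet:
  assumes "facial Y"
  obtains x where "x \<in> Y" "snd x \<in> choquet_boundary \<KK> A"
proof -
  obtain Z where Z: "facial Z" "Z \<subseteq> Y" and min: "\<And>W. facial W \<Longrightarrow> W \<subseteq> Z \<Longrightarrow> W = Z"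
    using facial_has_minimal[OF assms] by metis
  then obtain x where x: "x \<in> Z"
    unfolding facial_def by blast
  have x_phase: "x \<in> phases"
    using Z(1) x by (auto simp: facial_def)
  have const: "Re (ev y f) = Re (ev x f)" if f: "f \<in> A" and y: "y \<in> Z" for f y
  proof -
    obtain z where z: "z \<in> Z" "\<And>w. w \<in> Z \<Longrightarrow> Re (ev w f) \<le> Re (ev z f)"
      using facial_attains_max[OF Z(1), of f] by metis
    \<comment> \<open>By minimality the maximisers fill \<open>Z\<close>, so
      \<open>Re (ev w f)\<close> is constant on \<open>Z\<close>.\<close>
    have "{w \<in> Z. Re (ev w f) = Re (ev z f)} = Z"
      by (intro min facial_maximisers[OF Z(1) f z(1) _ z(2)]) auto
    then have "w \<in> Z \<Longrightarrow> Re (ev w f) = Re (ev z f)" for w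
      by blast
    with x y show ?thesis
      by metis
  qed
  have "dominated Z = {ev x}"
  proof
    show "dominated Z \<subseteq> {ev x}"
    proof
      fix \<phi> assume \<phi>: "\<phi> \<in> dominated Z"
      \<comment> \<open>Constancy on \<open>Z\<close> turns domination by varying witnesses into
        domination by \<open>ev x\<close> alone.\<close>
      then have "Re (\<phi> f) \<le> Re (ev x f)" if "f \<in> A" for f
        using const[OF that] that by (auto simp: dominated_def)
      then have "\<phi> = ev x"
        using \<phi> by (intro Re_le_imp_eq ev_in_dual_space x_phase) (auto simp: dominated_def dual_ball_iff)
      then show "\<phi> \<in> {ev x}"
        by simp
    qed
    show "{ev x} \<subseteq> dominated Z"
      using x ev_in_dual_ball[OF x_phase] by (auto simp: dominated_def)
  qed
  then have "ev x extreme_point_of dual_ball \<KK> A"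
    using Z(1) by (simp add: facial_def face_of_singleton)
  then have "snd x \<in> choquet_boundary \<KK> A"
    by (rule extreme_ev_imp_choquet[OF x_phase])
  with x Z(2) that show thesis
    by blast
qed

text \<open>The maximisers on \<open>Y\<close> form a facial set themselves, so one of them lies
  over the Choquet boundary.\<close>

lemma facial_maximum_at_choquet:
  assumes Y: "facial Y" and f: "f \<in> A"
  obtains x where "x \<in> Y" "snd x \<in> choquet_boundary \<KK> A"
    "\<And>y. y \<in> Y \<Longrightarrow> Re (ev y f) \<le> Re (ev x f)"
proof -
  obtain z where z: "z \<in> Y" "\<And>w. w \<in> Y \<Longrightarrow> Re (ev w f) \<le> Re (ev z f)"
    using facial_attains_max[OF Y, of f] by metis
  have "facial {w \<in> Y. Re (ev w f) = Re (ev z f)}"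
    by (rule facial_maximisers[OF Y f z(1) _ z(2)]) auto
  then obtain x where "x \<in> {w \<in> Y. Re (ev w f) = Re (ev z f)}" "snd x \<in> choquet_boundary \<KK> A"
    by (rule facial_meets_choquet)
  with z show thesis
    by (intro that[of x]) simp_all
qed

lemma facial_norming:
  assumes "f \<in> A"
  shows "facial (norming f)"
proof -
  obtain x where x: "x \<in> norming f"
    using norm_attained[OF assms] .
  show ?thesis
    unfolding norming_def
  proof (rule facial_maximisers[OF facial_phases assms])
    show "x \<in> phases" "Re (ev x f) = norm f"
      using x by (auto simp: norming_def)
    show "Re (ev y f) \<le> norm f" if "y \<in> phases" for y
      using norm_ev_le[OF that, of f] complex_Re_le_cmod[of "ev y f"] by linarith
  qed
qed

section \<open>Birkhoff-James orthogonality and the convex hull\<close>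

text \<open>The set in both statements of the theorem, parametrised by norming pairs.\<close>

definition support_values :: "('a \<Rightarrow>\<^sub>C complex) \<Rightarrow> ('a \<Rightarrow>\<^sub>C complex) \<Rightarrow> complex set" where
  "support_values f g = (\<lambda>x. ev x g) ` {x \<in> norming f. snd x \<in> choquet_boundary \<KK> A}"

lemma support_values_eq:
  assumes f: "f \<in> A" and g: "g \<in> A"
  shows "{\<theta> * apply_bcontfun g s | \<theta> s. \<theta> \<in> unimodular \<KK> \<and> s \<in> choquet_boundary \<KK> A \<and>
    apply_bcontfun f s = cnj \<theta> * of_real (norm f)} = support_values f g"
proof -
  have "apply_bcontfun f s = cnj \<theta> * of_real (norm f) \<longleftrightarrow> (\<theta>, s) \<in> norming f"
    if \<theta>: "\<theta> \<in> unimodular \<KK>" for \<theta> s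
  proof -
    have unit: "\<theta> * cnj \<theta> = 1"
      using \<theta> by (simp add: unimodular_def complex_norm_square[symmetric])
    have "(\<theta>, s) \<in> norming f \<longleftrightarrow> \<theta> * apply_bcontfun f s = of_real (norm f)"
    proof
      assume "(\<theta>, s) \<in> norming f"
      from ev_norming[OF this] f show "\<theta> * apply_bcontfun f s = of_real (norm f)"
        by (simp add: ev_def)
    next
      assume "\<theta> * apply_bcontfun f s = of_real (norm f)"
      with \<theta> f show "(\<theta>, s) \<in> norming f"
        by (simp add: norming_def phases_def ev_def del: times_complex.sel)
    qed
    also have "\<dots> \<longleftrightarrow> apply_bcontfun f s = cnj \<theta> * of_real (norm f)"
      using unit by (metis mult.assoc mult.commute mult.left_neutral)
    finally show ?thesis ..
  qed
  note * = this
  have **: "x \<in> norming f \<Longrightarrow> fst x \<in> unimodular \<KK>" for x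
    by (auto simp: norming_def phases_def)
  show ?thesis
    unfolding support_values_def using g * **
    by (force simp: ev_def image_iff)
qed

lemma support_values_nonempty:
  assumes "f \<in> A"
  shows "support_values f g \<noteq> {}"
proof -
  obtain x where "x \<in> norming f" "snd x \<in> choquet_boundary \<KK> A"
    using facial_meets_choquet[OF facial_norming[OF assms]] .
  then show ?thesis
    unfolding support_values_def by blast
qed

text \<open>Orthogonality gives \<open>norm (c g + n f) \<ge> n * norm f\<close>. The pairs norming
  \<open>c g + n f\<close> are then the witnesses from which the limit argument produces a pair
  norming \<open>f\<close>.\<close>

lemma birkhoff_orthogonal_norming:
  assumes f: "f \<in> A" and g: "g \<in> A" and orth: "birkhoff_orthogonal \<KK> f g" and c: "c \<in> \<KK>"
  shows "\<exists>x\<in>norming f. 0 \<le> Re (c * ev x g)"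
proof -
  define h where "h = cscale c g"
  have h: "h \<in> A"
    using c g by (simp add: h_def scale_closed)
  have "\<exists>x\<in>phases. Re (ev x f) = norm f \<and> 0 \<le> Re (ev x h)"
  proof (rule compact_lexicographic_witness[OF compact_phases])
    fix n :: nat
    have "real n * norm f \<le> norm (h + real n *\<^sub>R f)"
    proof (cases "n = 0")
      case False
      have "f + cscale (of_real (inverse (real n)) * c) g = inverse (real n) *\<^sub>R (h + real n *\<^sub>R f)"
        using False by (intro bcontfun_eqI) (simp add: h_def scaleR_conv_of_real field_simps)
      moreover have "norm f \<le> norm (f + cscale (of_real (inverse (real n)) * c) g)"
        using orth c unfolding birkhoff_orthogonal_def by (blast intro: scalars_mult of_real_in_scalars)
      ultimately have "norm f \<le> inverse (real n) * norm (h + real n *\<^sub>R f)"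
        by simp
      with False show ?thesis
        by (simp add: field_simps)
    qed simp
    moreover obtain x where "x \<in> norming (h + real n *\<^sub>R f)"
      using norm_attained[OF add_closed[OF h scaleR_closed[OF f]]] .
    ultimately show "\<exists>x\<in>phases. 0 \<le> Re (ev x h) + real n * (Re (ev x f) - norm f)"
      by (intro bexI[of _ x])
         (auto simp: norming_def ev_add h f scaleR_closed ev_scaleR algebra_simps)
  next
    show "Re (ev x f) \<le> norm f" if "x \<in> phases" for x
      using norm_ev_le[OF that, of f] complex_Re_le_cmod[of "ev x f"] by linarith
  qed (auto intro!: continuous_intros continuous_on_ev)
  then show ?thesis
    using ev_cscale[OF c g] by (auto simp: norming_def h_def)
qed

text \<open>The support values are real, and the scalars 1 and -1 yield two of them with 0 in
  between.\<close>

lemma birkhoff_orthogonal_imp_zero_in_hull_real: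
  assumes real: "\<KK> = \<real>" and f: "f \<in> A" and g: "g \<in> A" and orth: "birkhoff_orthogonal \<KK> f g"
  shows "0 \<in> convex hull (support_values f g)"
proof -
  have wit: "\<exists>d\<in>support_values f g. 0 \<le> Re (c * d)" if c: "c \<in> \<KK>" for c
  proof -
    obtain x where x: "x \<in> norming f" "snd x \<in> choquet_boundary \<KK> A"
        "\<And>y. y \<in> norming f \<Longrightarrow> Re (ev y (cscale c g)) \<le> Re (ev x (cscale c g))"
      using facial_maximum_at_choquet[OF facial_norming[OF f] scale_closed[OF c g]] by metis
    moreover obtain y where "y \<in> norming f" "0 \<le> Re (c * ev y g)"
      using birkhoff_orthogonal_norming[OF f g orth c] by blast
    ultimately have "0 \<le> Re (c * ev x g)"
      unfolding ev_cscale[OF c g] by (meson order_trans)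
    with x(1,2) show ?thesis
      unfolding support_values_def by blast
  qed
  obtain a b where ab: "a \<in> support_values f g" "0 \<le> Re a" "b \<in> support_values f g" "Re b \<le> 0"
    using wit[of 1] wit[of "-1"] by auto
  have "Im d = 0" if d: "d \<in> support_values f g" for d
  proof -
    have "d \<in> \<KK>"
      using d ev_in_dual_space g by (auto simp: support_values_def norming_def dual_space_def)
    then show ?thesis
      using real by (simp add: complex_is_Real_iff)
  qed
  \<comment> \<open>Multiplication by \<open>\<i>\<close> turns the real line into the imaginary
    axis.\<close>
  then have "0 \<in> closed_segment a b"
    using ab by (intro zero_in_segment_if_Im_opposite[of \<i>]) auto
  then show ?thesis
    using ab by (meson closed_segment_subset_convex_hull hull_inc subsetD)
qed

lemma birkhoff_orthogonal_imp_zero_in_hull_complex: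
  assumes complex: "\<KK> = UNIV" and f: "f \<in> A" and g: "g \<in> A" and orth: "birkhoff_orthogonal \<KK> f g"
  shows "0 \<in> convex hull (support_values f g)"
proof (rule ccontr)
  assume contra: "0 \<notin> convex hull (support_values f g)"
  then obtain a where a: "a \<noteq> 0" "\<And>d. d \<in> convex hull (support_values f g) \<Longrightarrow> 0 \<le> a \<bullet> d"
    using separating_hyperplane_set_0[OF convex_convex_hull] by blast
  \<comment> \<open>With this choice \<open>Re (l * d)\<close> equals
    \<open>- (a \<bullet> d)\<close>.\<close>
  define l where "l = - cnj a"
  have l: "l \<noteq> 0" "l \<in> \<KK>"
    using a complex by (auto simp: l_def)
  have sep: "Re (l * d) \<le> 0" if "d \<in> support_values f g" for d
    using a(2)[OF hull_inc[OF that]] by (simp add: l_def inner_complex_def)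
  have lg: "cscale l g \<in> A"
    using l g by (simp add: scale_closed)
  obtain x where x: "x \<in> norming f" "snd x \<in> choquet_boundary \<KK> A"
      "\<And>y. y \<in> norming f \<Longrightarrow> Re (ev y (cscale l g)) \<le> Re (ev x (cscale l g))"
    using facial_maximum_at_choquet[OF facial_norming[OF f] lg] by metis
  have "Re (l * ev x g) \<le> 0"
    using x sep by (auto simp: support_values_def)
  \<comment> \<open>The maximum over all norming pairs is attained over the Choquet boundary, so the
    bound on the support values extends to every norming pair.\<close>
  then have le: "Re (l * ev y g) \<le> 0" if "y \<in> norming f" for y
    using x(3)[OF that] by (simp add: ev_cscale[OF l(2) g])
  define Z where "Z = {y \<in> norming f. Re (ev y (cscale l g)) = 0}"
  have wit: "\<exists>d\<in>support_values f g. Re (l * d) = 0 \<and> 0 \<le> Re (r * \<i> * l * d)" for r :: complex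
  proof -
    have lr: "r * \<i> * l \<in> \<KK>"
      using complex by simp
    have "\<exists>y\<in>norming f. Re (l * ev y g) = 0 \<and> 0 \<le> Re (r * \<i> * l * ev y g)"
    proof (rule compact_lexicographic_witness)
      show "compact (norming f)"
        using facial_norming[OF f] by (auto simp: facial_def intro: compact_subset_phases)
      fix n :: nat
      \<comment> \<open>As \<open>n\<close> grows, the term \<open>n * l\<close> penalises negative
        values of \<open>Re (l * ev y g)\<close>, so that the limit pair attains 0.\<close>
      have "\<exists>y\<in>norming f. 0 \<le> Re ((r * \<i> * l + of_nat n * l) * ev y g)"
        using complex by (intro birkhoff_orthogonal_norming[OF f g orth]) simp
      then show "\<exists>y\<in>norming f. 0 \<le> Re (r * \<i> * l * ev y g) + real n * (Re (l * ev y g) - 0)"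
        by (simp add: distrib_right mult.assoc)
    qed (auto intro!: continuous_intros continuous_on_ev le simp del: times_complex.sel)
    then obtain z where z: "z \<in> norming f" "Re (l * ev z g) = 0" "0 \<le> Re (r * \<i> * l * ev z g)"
      by blast
    \<comment> \<open>The value 0 at \<open>z\<close> is the maximum, so \<open>Z\<close> consists
      of maximisers. Maximising once more on \<open>Z\<close> replaces \<open>z\<close> by a pair
      over the Choquet boundary.\<close>
    have "facial Z"
      unfolding Z_def
      by (rule facial_maximisers[OF facial_norming[OF f] lg z(1)])
         (use z le in \<open>auto simp: ev_cscale[OF l(2) g] simp del: times_complex.sel\<close>)
    then obtain w where w: "w \<in> Z" "snd w \<in> choquet_boundary \<KK> A"
        "\<And>y. y \<in> Z \<Longrightarrow> Re (ev y (cscale (r * \<i> * l) g)) \<le> Re (ev w (cscale (r * \<i> * l) g))"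
      using facial_maximum_at_choquet[OF _ scale_closed[OF lr g]] by metis
    have "z \<in> Z"
      using z by (simp add: Z_def ev_cscale[OF l(2) g] del: times_complex.sel)
    then have "0 \<le> Re (r * \<i> * l * ev w g)"
      using w(3)[of z] z(3) unfolding ev_cscale[OF lr g] by linarith
    moreover have "w \<in> norming f" "Re (l * ev w g) = 0"
      using w(1) by (simp_all add: Z_def ev_cscale[OF l(2) g] del: times_complex.sel)
    ultimately show ?thesis
      using w(2) unfolding support_values_def by blast
  qed
  \<comment> \<open>The choices \<open>r = -1\<close> and \<open>r = 1\<close> give the two signs of
    the imaginary part.\<close>
  obtain p q where "p \<in> support_values f g" "q \<in> support_values f g"
    "Re (l * p) = 0" "Re (l * q) = 0" "0 \<le> Re (- 1 * \<i> * l * p)" "0 \<le> Re (1 * \<i> * l * q)"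
    using wit by metis
  moreover have "Re (- 1 * \<i> * l * p) = Im (l * p)" "Re (1 * \<i> * l * q) = - Im (l * q)"
    by simp_all
  ultimately have "0 \<in> closed_segment p q"
    using l by (intro zero_in_segment_if_Im_opposite[of l]) auto
  with \<open>p \<in> _\<close> \<open>q \<in> _\<close> contra show False
    by (meson closed_segment_subset_convex_hull hull_inc subsetD)
qed

text \<open>If \<open>Re (c * d)\<close> were negative at every support value, it would be negative
  on the hull, which contains 0. So some norming pair has \<open>Re (c * ev x g) \<ge> 0\<close>,
  and it sends \<open>f + c g\<close> to a value of real part at least
  \<open>norm f\<close>.\<close>

lemma zero_in_hull_imp_birkhoff_orthogonal:
  assumes f: "f \<in> A" and g: "g \<in> A" and zero: "0 \<in> convex hull (support_values f g)"
  shows "birkhoff_orthogonal \<KK> f g"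
  unfolding birkhoff_orthogonal_def
proof
  fix c assume c: "c \<in> \<KK>"
  have "\<exists>d\<in>support_values f g. 0 \<le> Re (c * d)"
  proof (rule ccontr)
    assume "\<not> ?thesis"
    then have "support_values f g \<subseteq> {d. cnj c \<bullet> d < 0}"
      by (force simp: inner_complex_def not_le)
    then have "convex hull (support_values f g) \<subseteq> {d. cnj c \<bullet> d < 0}"
      by (rule hull_minimal) (rule convex_halfspace_lt)
    with zero show False
      by auto
  qed
  then obtain x where x: "x \<in> norming f" "0 \<le> Re (c * ev x g)"
    by (auto simp: support_values_def)
  have "norm f \<le> Re (ev x (f + cscale c g))"
    using x f g c by (simp add: norming_def ev_add scale_closed ev_cscale)
  also have "\<dots> \<le> norm (ev x (f + cscale c g))"
    by (rule complex_Re_le_cmod)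
  also have "\<dots> \<le> norm (f + cscale c g)"
    using x by (auto simp: norming_def intro: norm_ev_le)
  finally show "norm f \<le> norm (f + cscale c g)" .
qed

lemma birkhoff_orthogonal_iff:
  assumes "f \<in> A" and "g \<in> A"
  shows "birkhoff_orthogonal \<KK> f g \<longleftrightarrow> 0 \<in> convex hull (support_values f g)"
  using scalars assms birkhoff_orthogonal_imp_zero_in_hull_real
    birkhoff_orthogonal_imp_zero_in_hull_complex zero_in_hull_imp_birkhoff_orthogonal by blast

section \<open>Smooth points and supporting functionals\<close>

lemma smooth_point_iff:
  assumes f: "f \<in> A"
  shows "smooth_point \<KK> A f \<longleftrightarrow> (\<forall>g\<in>A. is_singleton (support_values f g))"
proof
  define S where "S = {\<phi> \<in> dual_space \<KK> A. dual_norm A \<phi> = 1 \<and> \<phi> f = of_real (norm f)}"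
  have ev_S: "ev x \<in> S" if "x \<in> norming f" for x
    using that ev_norming[OF that] dual_norm_ev ev_in_dual_space
    by (auto simp: S_def norming_def)
  have smooth: "smooth_point \<KK> A f \<longleftrightarrow> is_singleton S"
    using f by (simp add: smooth_point_def S_def)
  {
    assume "smooth_point \<KK> A f"
    then obtain \<phi> where "S = {\<phi>}"
      unfolding smooth is_singleton_def by blast
    \<comment> \<open>Every norming pair gives a functional supporting \<open>f\<close>, so
      uniqueness leaves a single value at \<open>g\<close>.\<close>
    then have "support_values f g \<subseteq> {\<phi> g}" for g
      using ev_S by (auto simp: support_values_def)
    then show "\<forall>g\<in>A. is_singleton (support_values f g)"
      using support_values_nonempty[OF f] by (metis is_singletonI subset_singletonD)
  }
  assume single: "\<forall>g\<in>A. is_singleton (support_values f g)"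
  obtain x where x: "x \<in> norming f" "snd x \<in> choquet_boundary \<KK> A"
    using facial_meets_choquet[OF facial_norming[OF f]] .
  have "\<phi> = ev x" if \<phi>: "\<phi> \<in> S" for \<phi>
  proof (rule Re_le_imp_eq)
    show "\<phi> \<in> dual_space \<KK> A" "ev x \<in> dual_space \<KK> A"
      using \<phi> ev_S[OF x(1)] by (auto simp: S_def)
    fix g assume g: "g \<in> A"
    have "\<phi> \<in> dominated phases"
      using \<phi> unfolding dominated_phases by (simp add: S_def dual_ball_def)
    moreover have "Re (ev y f) \<le> norm f" if "y \<in> phases" for y
      using norm_ev_le[OF that, of f] complex_Re_le_cmod[of "ev y f"] by linarith
    \<comment> \<open>Supporting \<open>f\<close> means attaining the maximum \<open>norm f\<close>
      over \<open>phases\<close>, so domination by all pairs sharpens to domination by the norming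
      ones.\<close>
    ultimately have "\<phi> \<in> dominated (norming f)"
      unfolding norming_def using \<phi> compact_imp_closed[OF compact_phases]
      by (subst dominated_maximisers[OF order_refl _ f]) (auto simp: S_def)
    then obtain y where y: "y \<in> norming f" "Re (\<phi> g) \<le> Re (ev y g)"
      using g by (auto simp: dominated_def)
    obtain z where z: "z \<in> norming f" "snd z \<in> choquet_boundary \<KK> A"
        "\<And>y. y \<in> norming f \<Longrightarrow> Re (ev y g) \<le> Re (ev z g)"
      using facial_maximum_at_choquet[OF facial_norming[OF f] g] by metis
    have "ev z g \<in> support_values f g" "ev x g \<in> support_values f g"
      using x z by (auto simp: support_values_def)
    \<comment> \<open>The maximiser \<open>z\<close> depends on \<open>g\<close>, but the singleton
      identifies its value with that of \<open>x\<close>, which was fixed before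
      \<open>g\<close>.\<close>
    then have "ev z g = ev x g"
      using single g by (metis is_singletonE singletonD)
    with y z(3)[OF y(1)] show "Re (\<phi> g) \<le> Re (ev x g)"
      by simp
  qed
  then have "S = {ev x}"
    using ev_S[OF x(1)] by blast
  then show "smooth_point \<KK> A f"
    unfolding smooth by simp
qed

end

theorem corollary3p6:
  fixes \<KK> :: "complex set"
    and A :: "('a::t2_space \<Rightarrow>\<^sub>C complex) set"
  assumes "\<KK> = \<real> \<or> \<KK> = UNIV"
    and "compact (UNIV :: 'a set)"
    and "unital_uniform_algebra \<KK> A"
  shows "(\<forall>f\<in>A. \<forall>g\<in>A. birkhoff_orthogonal \<KK> f g \<longleftrightarrow>
            0 \<in> convex hull {\<theta> * apply_bcontfun g s | \<theta> s. \<theta> \<in> unimodular \<KK> \<and> s \<in> choquet_boundary \<KK> A \<and>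
                                apply_bcontfun f s = cnj \<theta> * of_real (norm f)})
       \<and> (\<forall>f\<in>A. smooth_point \<KK> A f \<longleftrightarrow>
            (\<forall>g\<in>A. is_singleton {\<theta> * apply_bcontfun g s | \<theta> s. \<theta> \<in> unimodular \<KK> \<and> s \<in> choquet_boundary \<KK> A \<and>
                                apply_bcontfun f s = cnj \<theta> * of_real (norm f)}))"
proof -
  interpret compact_uniform_algebra \<KK> A
    using assms by unfold_locales
  show ?thesis
    by (simp add: support_values_eq birkhoff_orthogonal_iff smooth_point_iff)
qed

end
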